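(* Let $\mathcal H$ be a real Hilbert space, $M\in\mathcal M(\mathcal H)$, $\beta\ge 0$, let $A:\mathcal H\to 2^{\mathcal H}$ be maximally monotone, let $C:\mathcal H\to\mathcal H$ be $\frac1\beta$-cocoercive with respect to $\|\cdot\|_M$, and assume that $\operatorname{zer}(A+C)=\{x\in\mathcal H: 0\in Ax+Cx\}$ is nonempty. Let $\varepsilon>0$, $\epsilon_0,\epsilon_1\ge0$, $\lambda_0>0$, and suppose that the parameters of Algorithm 1 (described in the context) satisfy, for all $n\in\mathbb N$: $\mu_n=\frac1{\lambda_0}\lambda_n^2-\lambda_n$; $0\le\zeta_n\le1-\epsilon_0$; $\varepsilon\le\gamma_n\bar\beta\le4-2\lambda_0-\varepsilon$; $\lambda_{n+1}\ge\lambda_n$; $\gamma_{n+1}\lambda_{n+1}-\gamma_n\lambda_n\le\gamma_{n+1}\lambda_0-\epsilon_1$; and $\bar\beta\ge\beta$. Let $x^\star$ be an arbitrary point of $\operatorname{zer}(A+C)$ and, for sequences generated by Algorithm 1, let $\ell_n$ be as defined there, $\ell_{-1}=0$, $$\phi_n=\Big\langle \tfrac{z_n-p_n}{\gamma_n},\,p_n-x^\star\Big\rangle_M+\tfrac{\bar\beta}{4}\|y_n-p_n\|_M^2,\qquad V_0=\|x_0-x^\star\|_M^2,$$ $$V_{n+1}=\|x_{n+1}-x^\star\|_M^2+2\lambda_{n+1}\gamma_{n+1}\alpha_{n+1}\phi_n+\ell_n .$$ Then, for all $n\in\mathbb N$: (i) $\displaystyle \zeta_{n+1}\ell_n\ge\tfrac{\zeta_{n+1}\theta_n}{2}\Big\|p_n-x_n+\alpha_n(x_n-p_{n-1})+\tfrac{\gamma_n\bar\beta\lambda_n^2}{\hat\theta_n}u_n-\tfrac{2\bar\theta_n}{\theta_n}v_n\Big\|_M^2\ge0$;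 (ii) $\displaystyle (\lambda_{n+1}+\mu_{n+1})\Big(\tfrac{\tilde\theta_{n+1}}{\hat\theta_{n+1}}\|u_{n+1}\|_M^2+\tfrac{\hat\theta_{n+1}}{\theta_{n+1}}\|v_{n+1}\|_M^2\Big)\ge0$; (iii) $\phi_n\ge0$; more specifically, if $\beta>0$, $$\phi_n\ge\tfrac{\bar\beta}{4}\Big\|\tfrac{2}{\bar\beta}(Cy_n-Cx^\star)+M(p_n-y_n)\Big\|_{M^{-1}}^2+\tfrac{\bar\beta-\beta}{\bar\beta\beta}\|Cy_n-Cx^\star\|_{M^{-1}}^2\ge0,$$ and if $\beta=0$, $\phi_n\ge\tfrac{\bar\beta}{4}\|p_n-y_n\|_M^2\ge0$; (iv) $V_n\ge0$; (v) $V_{n+1}+2\gamma_n(\lambda_n-\bar\alpha_{n+1}\lambda_{n+1})\phi_n+(1-\zeta_n)\ell_{n-1}\le V_n$.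
   Context: $\mathbb N=\{0,1,2,\dots\}$. $\mathcal M(\mathcal H)$ is the set of bounded linear, self-adjoint, strongly positive operators on $\mathcal H$; for $M\in\mathcal M(\mathcal H)$, $\langle x,y\rangle_M=\langle x,My\rangle$, $\|x\|_M=\sqrt{\langle x,Mx\rangle}$ and $\|x\|_{M^{-1}}=\sqrt{\langle x,M^{-1}x\rangle}$. $C$ is $\frac1\beta$-cocoercive ($\beta\ge0$) w.r.t. $\|\cdot\|_M$ if $\beta\langle Cx-Cy,x-y\rangle\ge\|Cx-Cy\|_{M^{-1}}^2$ for all $x,y\in\mathcal H$. Algorithm 1. Input: $x_0\in\mathcal H$; strictly positive sequences $(\gamma_n)_{n\in\mathbb N}$, $(\lambda_n)_{n\in\mathbb N}$; non-negative sequences $(\zeta_n)_{n\in\mathbb N}$, $(\mu_n)_{n\in\mathbb N}$; $\bar\beta\ge\beta\ge0$; $M\in\mathcal M(\mathcal H)$. Set $\gamma_{-1}=\gamma_0$ and, for $n\in\mathbb N$, $\alpha_n=\frac{\mu_n}{\lambda_n+\mu_n}$, $\bar\alpha_n=\frac{\gamma_n\mu_n}{\gamma_{n-1}(\lambda_n+\mu_n)}$, $\theta_n=(4-\gamma_n\bar\beta)(\lambda_n+\mu_n)-2\lambda_n^2$, $\hat\theta_n=2\lambda_n+2\mu_n-\gamma_n\bar\beta\lambda_n^2$, $\bar\theta_n=\lambda_n+\mu_n-\lambda_n^2$, $\tilde\theta_n=(\lambda_n+\mu_n)\gamma_n\bar\beta$. Initialize $y_{-1}=p_{-1}=z_{-1}=x_0$,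 $u_0=v_0=0$. For $n=0,1,2,\dots$: $$y_n=x_n+\alpha_n(y_{n-1}-x_n)+u_n,$$ $$z_n=x_n+\alpha_n(p_{n-1}-x_n)+\bar\alpha_n(z_{n-1}-p_{n-1})+\tfrac{\bar\theta_n\gamma_n\bar\beta}{\hat\theta_n}u_n+v_n,$$ $$p_n=(M+\gamma_nA)^{-1}(Mz_n-\gamma_nCy_n),$$ $$x_{n+1}=x_n+\lambda_n(p_n-z_n)+\bar\alpha_n\lambda_n(z_{n-1}-p_{n-1}),$$ and then choose any $u_{n+1},v_{n+1}\in\mathcal H$ satisfying the safeguarding condition $$(\lambda_{n+1}+\mu_{n+1})\Big(\tfrac{\tilde\theta_{n+1}}{\hat\theta_{n+1}}\|u_{n+1}\|_M^2+\tfrac{\hat\theta_{n+1}}{\theta_{n+1}}\|v_{n+1}\|_M^2\Big)\le\zeta_{n+1}\ell_n,$$ where $$\ell_n=\tfrac{\theta_n}{2}\Big\|p_n-x_n+\alpha_n(x_n-p_{n-1})+\tfrac{\gamma_n\bar\beta\lambda_n^2}{\hat\theta_n}u_n-\tfrac{2\bar\theta_n}{\theta_n}v_n\Big\|_M^2+2\mu_n\gamma_n\Big\langle\tfrac{z_n-p_n}{\gamma_n}-\tfrac{z_{n-1}-p_{n-1}}{\gamma_{n-1}},p_n-p_{n-1}\Big\rangle_M+\tfrac{\mu_n\gamma_n\bar\beta}{2}\|p_n-y_n-(p_{n-1}-y_{n-1})\|_M^2.$$ *)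

theory Defs
  imports "HOL-Analysis.Analysis"
begin

definition metric_ops :: "('h::real_inner \<Rightarrow> 'h) set" where
  "metric_ops = {M. bounded_linear M \<and> (\<forall>x y. inner (M x) y = inner x (M y)) \<and>
     (\<exists>c>0. \<forall>x. c * (norm x)\<^sup>2 \<le> inner x (M x))}"

definition inner_M :: "('h::real_inner \<Rightarrow> 'h) \<Rightarrow> 'h \<Rightarrow> 'h \<Rightarrow> real" where
  "inner_M M x y = inner x (M y)"

text \<open>The dual norm of \<open>x\<close> is \<open>norm_M (inv M) x\<close>; on a Hilbert space every member of
  \<^const>\<open>metric_ops\<close> is bijective, so \<open>inv M\<close> is its genuine inverse.\<close>

definition norm_M :: "('h::real_inner \<Rightarrow> 'h) \<Rightarrow> 'h \<Rightarrow> real" where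
  "norm_M M x = sqrt (inner x (M x))"

definition monotone_operator :: "('h::real_inner \<Rightarrow> 'h set) \<Rightarrow> bool" where
  "monotone_operator A \<longleftrightarrow>
     (\<forall>x y. \<forall>a\<in>A x. \<forall>b\<in>A y. 0 \<le> inner (a - b) (x - y))"

definition maximally_monotone :: "('h::real_inner \<Rightarrow> 'h set) \<Rightarrow> bool" where
  "maximally_monotone A \<longleftrightarrow> monotone_operator A \<and>
     (\<forall>B. monotone_operator B \<and> (\<forall>x. A x \<subseteq> B x) \<longrightarrow> B = A)"

definition zer_sum :: "('h::real_inner \<Rightarrow> 'h set) \<Rightarrow> ('h \<Rightarrow> 'h) \<Rightarrow> 'h set" where
  "zer_sum A C = {x. 0 \<in> {a + C x |a. a \<in> A x}}"

text \<open>The set-valued inverse of \<open>M + g A\<close>. For \<open>M \<in> metric_ops\<close>, \<open>g > 0\<close> and monotone \<open>A\<close>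
  it has at most one value at each point, so membership expresses \<open>p = (M + g A)\<^sup>-\<^sup>1 w\<close>.\<close>

definition resolvent ::
  "('h::real_inner \<Rightarrow> 'h) \<Rightarrow> real \<Rightarrow> ('h \<Rightarrow> 'h set) \<Rightarrow> 'h \<Rightarrow> 'h set" where
  "resolvent M g A w = {p. w \<in> {M p + g *\<^sub>R a |a. a \<in> A p}}"

text \<open>\<open>C\<close> is \<open>1/\<beta>\<close>-cocoercive with respect to the norm induced by \<open>M\<close>; \<open>\<beta> = 0\<close> is allowed.\<close>

definition cocoercive_wrt :: "('h::real_inner \<Rightarrow> 'h) \<Rightarrow> real \<Rightarrow> ('h \<Rightarrow> 'h) \<Rightarrow> bool" where
  "cocoercive_wrt M \<beta> C \<longleftrightarrow>
     (\<forall>x y. \<beta> * inner (C x - C y) (x - y) \<ge> (norm_M (inv M) (C x - C y))\<^sup>2)"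

text \<open>\<open>prev s0 s n\<close> is the term of index \<open>n - 1\<close> of the sequence \<open>s\<close> extended by the value \<open>s0\<close>
  at index \<open>-1\<close>.\<close>

definition prev :: "'b \<Rightarrow> (nat \<Rightarrow> 'b) \<Rightarrow> nat \<Rightarrow> 'b" where
  "prev s0 s n = (case n of 0 \<Rightarrow> s0 | Suc k \<Rightarrow> s k)"

definition alpha :: "(nat \<Rightarrow> real) \<Rightarrow> (nat \<Rightarrow> real) \<Rightarrow> nat \<Rightarrow> real" where
  "alpha lam mu n = mu n / (lam n + mu n)"

definition alpha_bar ::
  "(nat \<Rightarrow> real) \<Rightarrow> (nat \<Rightarrow> real) \<Rightarrow> (nat \<Rightarrow> real) \<Rightarrow> nat \<Rightarrow> real" where
  "alpha_bar gam lam mu n = (gam n * mu n) / (prev (gam 0) gam n * (lam n + mu n))"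

definition theta ::
  "(nat \<Rightarrow> real) \<Rightarrow> (nat \<Rightarrow> real) \<Rightarrow> (nat \<Rightarrow> real) \<Rightarrow> real \<Rightarrow> nat \<Rightarrow> real" where
  "theta gam lam mu bbar n = (4 - gam n * bbar) * (lam n + mu n) - 2 * (lam n)\<^sup>2"

definition theta_hat ::
  "(nat \<Rightarrow> real) \<Rightarrow> (nat \<Rightarrow> real) \<Rightarrow> (nat \<Rightarrow> real) \<Rightarrow> real \<Rightarrow> nat \<Rightarrow> real" where
  "theta_hat gam lam mu bbar n = 2 * lam n + 2 * mu n - gam n * bbar * (lam n)\<^sup>2"

definition theta_bar :: "(nat \<Rightarrow> real) \<Rightarrow> (nat \<Rightarrow> real) \<Rightarrow> nat \<Rightarrow> real" where
  "theta_bar lam mu n = lam n + mu n - (lam n)\<^sup>2"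

definition theta_tilde ::
  "(nat \<Rightarrow> real) \<Rightarrow> (nat \<Rightarrow> real) \<Rightarrow> (nat \<Rightarrow> real) \<Rightarrow> real \<Rightarrow> nat \<Rightarrow> real" where
  "theta_tilde gam lam mu bbar n = (lam n + mu n) * gam n * bbar"

text \<open>The norm that appears in \<open>\<ell>\<^sub>n\<close> with factor \<open>\<theta>\<^sub>n / 2\<close>. Here and below
  the terms of index \<open>-1\<close> of \<open>y\<close>, \<open>z\<close> and \<open>p\<close> are all \<open>x 0\<close>.\<close>

definition ell_vec where
  "ell_vec gam lam mu bbar (x :: nat \<Rightarrow> 'h::real_inner) p u v n =
     p n - x n + alpha lam mu n *\<^sub>R (x n - prev (x 0) p n)
     + (gam n * bbar * (lam n)\<^sup>2 / theta_hat gam lam mu bbar n) *\<^sub>R u n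
     - (2 * theta_bar lam mu n / theta gam lam mu bbar n) *\<^sub>R v n"

definition ell where
  "ell M gam lam mu bbar (x :: nat \<Rightarrow> 'h::real_inner) y z p u v n =
     theta gam lam mu bbar n / 2 * (norm_M M (ell_vec gam lam mu bbar x p u v n))\<^sup>2
     + 2 * mu n * gam n *
         inner_M M ((1 / gam n) *\<^sub>R (z n - p n)
                     - (1 / prev (gam 0) gam n) *\<^sub>R (prev (x 0) z n - prev (x 0) p n))
                   (p n - prev (x 0) p n)
     + mu n * gam n * bbar / 2 *
         (norm_M M (p n - y n - (prev (x 0) p n - prev (x 0) y n)))\<^sup>2"

definition safeguard_lhs where
  "safeguard_lhs M gam lam mu bbar (u :: nat \<Rightarrow> 'h::real_inner) v n =
     (lam n + mu n) *
       (theta_tilde gam lam mu bbar n / theta_hat gam lam mu bbar n * (norm_M M (u n))\<^sup>2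
        + theta_hat gam lam mu bbar n / theta gam lam mu bbar n * (norm_M M (v n))\<^sup>2)"

definition generated_by_algorithm where
  "generated_by_algorithm M A C gam lam zeta mu bbar (x :: nat \<Rightarrow> 'h::real_inner) y z p u v \<longleftrightarrow>
     u 0 = 0 \<and> v 0 = 0 \<and>
     (\<forall>n. y n = x n + alpha lam mu n *\<^sub>R (prev (x 0) y n - x n) + u n) \<and>
     (\<forall>n. z n = x n + alpha lam mu n *\<^sub>R (prev (x 0) p n - x n)
            + alpha_bar gam lam mu n *\<^sub>R (prev (x 0) z n - prev (x 0) p n)
            + (theta_bar lam mu n * gam n * bbar / theta_hat gam lam mu bbar n) *\<^sub>R u n + v n) \<and>
     (\<forall>n. p n \<in> resolvent M (gam n) A (M (z n) - gam n *\<^sub>R C (y n))) \<and>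
     (\<forall>n. x (Suc n) = x n + lam n *\<^sub>R (p n - z n)
            + (alpha_bar gam lam mu n * lam n) *\<^sub>R (prev (x 0) z n - prev (x 0) p n)) \<and>
     (\<forall>n. safeguard_lhs M gam lam mu bbar u v (Suc n)
            \<le> zeta (Suc n) * ell M gam lam mu bbar x y z p u v n)"

definition phi where
  "phi M gam bbar (y :: nat \<Rightarrow> 'h::real_inner) z p xs n =
     inner_M M ((1 / gam n) *\<^sub>R (z n - p n)) (p n - xs) + bbar / 4 * (norm_M M (y n - p n))\<^sup>2"

definition V where
  "V M gam lam mu bbar (x :: nat \<Rightarrow> 'h::real_inner) y z p u v xs n =
     (case n of
        0 \<Rightarrow> (norm_M M (x 0 - xs))\<^sup>2
      | Suc k \<Rightarrow> (norm_M M (x (Suc k) - xs))\<^sup>2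
          + 2 * lam (Suc k) * gam (Suc k) * alpha lam mu (Suc k) * phi M gam bbar y z p xs k
          + ell M gam lam mu bbar x y z p u v k)"

end

theory Submission
  imports Defs
begin

text \<open>Write \<open>a n = (z n - p n) / gam n\<close> and \<open>q n = p n - y n\<close>. The resolvent step says that
  \<open>M (a n) - C (y n) \<in> A (p n)\<close>, while a solution satisfies \<open>- C xs \<in> A xs\<close>. Monotonicity of
  \<open>A\<close> between two such points, followed by cocoercivity of \<open>C\<close> and a completed square
  (\<open>cocoercive_three_point\<close>; for \<open>\<beta> = 0\<close> the map \<open>C\<close> is constant), bounds the product of the
  differences of \<open>a\<close> and \<open>p\<close>, plus \<open>bbar / 4\<close> times the squared difference of \<open>q\<close>, from below
  by a nonnegative number; \<open>a\<close> and \<open>q\<close> count as \<open>0\<close> at \<open>xs\<close>. Between \<open>p n\<close> and \<open>xs\<close> this sum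
  is \<open>phi\<close>, which gives (iii); between consecutive \<open>p\<close> it is, up to the factor \<open>2 mu gam\<close>, the
  part of \<open>ell\<close> that is not visibly nonnegative, which gives (i). With the signs of the \<open>\<theta>\<close>
  parameters, (ii) and (iv) follow.

  Claim (v) combines an exact identity with the safeguarding condition. The algorithm
  is designed such that with \<open>e = p n - x n + \<alpha> (x n - p (n - 1))\<close> the
  combinations \<open>gam n (a n - \<alpha> a (n - 1))\<close>, \<open>q n - \<alpha> q (n - 1)\<close> and \<open>x (n + 1) - x n\<close> all
  depend on \<open>e\<close>, \<open>u n\<close> and \<open>v n\<close> only. In the difference of \<open>V (n + 1)\<close> plus its correction
  in \<open>phi\<close> and \<open>V n\<close> without its term \<open>ell (n - 1)\<close>, everything else cancels thanks to
  \<open>lam \<alpha> = mu (1 - \<alpha>)\<close>. The remaining quadratic form in \<open>e, u, v\<close> equals the left-hand side of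
  the safeguarding condition (\<open>energy_balance\<close>), hence is at most \<open>zeta n * ell (n - 1)\<close>; at
  \<open>n = 0\<close> it is zero since \<open>u\<close> and \<open>v\<close> start at zero.\<close>

section \<open>The geometry of the metric\<close>

lemma inner_M_commute:
  assumes "M \<in> metric_ops"
  shows "inner_M M x y = inner_M M y x"
proof -
  have "inner (M y) x = inner y (M x)"
    using assms unfolding metric_ops_def by blast
  then show ?thesis
    by (simp add: inner_M_def inner_commute)
qed

lemma inner_M_bilinear:
  assumes "M \<in> metric_ops"
  shows "inner_M M (x + y) w = inner_M M x w + inner_M M y w"
    and "inner_M M (x - y) w = inner_M M x w - inner_M M y w"
    and "inner_M M (- x) w = - inner_M M x w"
    and "inner_M M (r *\<^sub>R x) w = r * inner_M M x w"
    and "inner_M M w (x + y) = inner_M M w x + inner_M M w y"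
    and "inner_M M w (x - y) = inner_M M w x - inner_M M w y"
    and "inner_M M w (- x) = - inner_M M w x"
    and "inner_M M w (r *\<^sub>R x) = r * inner_M M w x"
proof -
  interpret bounded_linear M
    using assms by (simp add: metric_ops_def)
  show "inner_M M (x + y) w = inner_M M x w + inner_M M y w"
    "inner_M M (x - y) w = inner_M M x w - inner_M M y w"
    "inner_M M (- x) w = - inner_M M x w"
    "inner_M M (r *\<^sub>R x) w = r * inner_M M x w"
    "inner_M M w (x + y) = inner_M M w x + inner_M M w y"
    "inner_M M w (x - y) = inner_M M w x - inner_M M w y"
    "inner_M M w (- x) = - inner_M M w x"
    "inner_M M w (r *\<^sub>R x) = r * inner_M M w x"
    by (simp_all add: inner_M_def add diff neg scaleR inner_add_left inner_add_right
        inner_diff_left inner_diff_right)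
qed

lemma inner_M_self_nonneg:
  assumes "M \<in> metric_ops"
  shows "0 \<le> inner_M M x x"
proof -
  obtain c where "c > 0" "c * (norm x)\<^sup>2 \<le> inner x (M x)"
    using assms by (auto simp: metric_ops_def)
  moreover have "0 \<le> c * (norm x)\<^sup>2"
    using \<open>c > 0\<close> by simp
  ultimately show ?thesis
    unfolding inner_M_def by linarith
qed

lemma norm_M_squared:
  assumes "M \<in> metric_ops"
  shows "(norm_M M x)\<^sup>2 = inner_M M x x"
  using inner_M_self_nonneg[OF assms, of x] by (simp add: norm_M_def inner_M_def)

text \<open>Injectivity is immediate from coercivity. For surjectivity, \<open>M x = w\<close> says that \<open>x\<close> is a
  fixed point of \<open>x \<mapsto> x - t (M x - w)\<close>. With \<open>c\<close> the coercivity constant and \<open>K\<close> a bound of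
  \<open>M\<close>, this map multiplies squared distances by at most \<open>1 - 2 t c + t\<^sup>2 K\<^sup>2\<close>, which is smaller
  than one for \<open>t = c / K\<^sup>2\<close>, so that Banach's fixed point theorem applies. This is where
  completeness of the space is needed.\<close>

lemma metric_ops_bij:
  fixes M :: "'h::{real_inner, complete_space} \<Rightarrow> 'h"
  assumes "M \<in> metric_ops"
  shows "bij M"
proof (rule bijI)
  interpret bounded_linear M
    using assms by (simp add: metric_ops_def)
  obtain c where c: "c > 0" "\<And>x. c * (norm x)\<^sup>2 \<le> inner x (M x)"
    using assms by (auto simp: metric_ops_def)
  show "inj M"
  proof (rule injI)
    fix x y
    assume "M x = M y"
    then have "c * (norm (x - y))\<^sup>2 \<le> 0"
      using c(2)[of "x - y"] by (simp add: diff)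
    then show "x = y"
      using c(1) by (simp add: mult_le_0_iff)
  qed
  obtain K where K: "K > 0" "\<And>x. norm (M x) \<le> norm x * K"
    using pos_bounded by blast
  define t where "t = c / K\<^sup>2"
  define q where "q = 1 - c\<^sup>2 / K\<^sup>2"
  have t: "t > 0"
    using c K by (simp add: t_def)
  have contr: "(norm (x - t *\<^sub>R M x))\<^sup>2 \<le> q * (norm x)\<^sup>2" for x
  proof -
    have "(norm (x - t *\<^sub>R M x))\<^sup>2 = (norm x)\<^sup>2 - 2 * t * inner x (M x) + t\<^sup>2 * (norm (M x))\<^sup>2"
      unfolding power2_norm_eq_inner
      by (simp add: inner_diff_left inner_diff_right inner_commute power2_eq_square algebra_simps)
    also have "\<dots> \<le> (norm x)\<^sup>2 - 2 * t * (c * (norm x)\<^sup>2) + t\<^sup>2 * (norm x * K)\<^sup>2"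
    proof -
      have "t * (c * (norm x)\<^sup>2) \<le> t * inner x (M x)"
        using c(2)[of x] t by simp
      moreover have "t\<^sup>2 * (norm (M x))\<^sup>2 \<le> t\<^sup>2 * (norm x * K)\<^sup>2"
        using K(2)[of x] by (intro mult_left_mono power_mono) auto
      ultimately show ?thesis
        by linarith
    qed
    also have "\<dots> = q * (norm x)\<^sup>2"
      using K(1) by (simp add: t_def q_def field_simps power2_eq_square)
    finally show ?thesis .
  qed
  have q1: "q < 1"
    using c K by (simp add: q_def)
  define r where "r = sqrt (max 0 q)"
  have r: "0 \<le> r" "r < 1" "q \<le> r\<^sup>2"
    using q1 by (auto simp: r_def)
  show "surj M"
  proof (rule surjI)
    fix w
    define f where "f x = x - t *\<^sub>R (M x - w)" for x
    have "dist (f x) (f y) \<le> r * dist x y" for x y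
    proof -
      have "f x - f y = (x - y) - t *\<^sub>R M (x - y)"
        by (simp add: f_def diff algebra_simps)
      then have "(norm (f x - f y))\<^sup>2 \<le> q * (norm (x - y))\<^sup>2"
        using contr[of "x - y"] by simp
      also have "\<dots> \<le> (r * norm (x - y))\<^sup>2"
        using r(3) by (simp add: power_mult_distrib mult_right_mono)
      finally show ?thesis
        unfolding dist_norm by (rule power2_le_imp_le) (simp add: r)
    qed
    then have "\<exists>!x\<in>UNIV. f x = x"
      using r by (intro Banach_fix[where c = r]) (auto intro: complete_UNIV)
    then obtain x where "f x = x"
      by blast
    then have "M x = w"
      using t by (simp add: f_def)
    then show "M (inv M w) = w"
      by (metis f_inv_into_f rangeI)
  qed
qed

text \<open>Every vector is \<open>M a\<close> for some \<open>a\<close>, which reduces the dual norm to the inner product given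
  by \<open>M\<close>.\<close>

lemma dual_norm_squared:
  fixes M :: "'h::{real_inner, complete_space} \<Rightarrow> 'h"
  assumes "M \<in> metric_ops"
  shows "(norm_M (inv M) (M a))\<^sup>2 = inner_M M a a"
proof -
  have "inv M (M a) = a"
    using metric_ops_bij[OF assms] by (simp add: bij_is_inj)
  then have "norm_M (inv M) (M a) = norm_M M a"
    by (simp add: norm_M_def inner_commute)
  then show ?thesis
    by (simp add: norm_M_squared[OF assms])
qed

section \<open>Monotonicity and cocoercivity\<close>

text \<open>Split \<open>p - p' = (y - y') + ((p - y) - (p' - y'))\<close>. Cocoercivity bounds the product of
  \<open>C y - C y'\<close> with the first part below by its squared dual norm over \<open>\<beta>\<close>; of this, the share with
  factor \<open>1 / bbar\<close> completes the square with the second part. Solutions (\<open>p' = y' = xs\<close>) and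
  consecutive iterates are both instances.\<close>

lemma cocoercive_three_point:
  fixes M :: "'h::{real_inner, complete_space} \<Rightarrow> 'h"
  assumes M: "M \<in> metric_ops" and C: "cocoercive_wrt M \<beta> C"
    and "0 < \<beta>" "\<beta> \<le> bbar"
  shows "bbar / 4 * (norm_M (inv M) ((2 / bbar) *\<^sub>R (C y - C y') + M ((p - y) - (p' - y'))))\<^sup>2
      + (bbar - \<beta>) / (bbar * \<beta>) * (norm_M (inv M) (C y - C y'))\<^sup>2
    \<le> inner (C y - C y') (p - p') + bbar / 4 * (norm_M M ((p - y) - (p' - y')))\<^sup>2"
proof -
  interpret bounded_linear M
    using M by (simp add: metric_ops_def)
  obtain d where d: "C y - C y' = M d"
    using metric_ops_bij[OF M] by (metis bij_pointE)
  define q where "q = (p - y) - (p' - y')"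
  have comb: "(2 / bbar) *\<^sub>R M d + M q = M ((2 / bbar) *\<^sub>R d + q)"
    by (simp add: add scaleR)
  have pq: "inner (M d) (p - p') = inner (M d) (y - y') + inner_M M d q"
    using inner_M_commute[OF M, of d q]
    by (simp add: q_def inner_M_def inner_diff_right inner_diff_left inner_commute)
  have "inner_M M d d \<le> \<beta> * inner (M d) (y - y')"
    using C[unfolded cocoercive_wrt_def, rule_format, of y y'] d
    by (simp add: dual_norm_squared[OF M])
  then have coco: "inner_M M d d / \<beta> \<le> inner (M d) (y - y')"
    using \<open>0 < \<beta>\<close> by (simp add: field_simps)
  have "bbar / 4 * inner_M M ((2 / bbar) *\<^sub>R d + q) ((2 / bbar) *\<^sub>R d + q)
      + (bbar - \<beta>) / (bbar * \<beta>) * inner_M M d d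
      = inner_M M d d / \<beta> + inner_M M d q + bbar / 4 * inner_M M q q"
    using assms(3,4) inner_M_commute[OF M, of q d]
    by (simp add: inner_M_bilinear[OF M] field_simps)
  then show ?thesis
    using coco unfolding d q_def[symmetric] comb dual_norm_squared[OF M] norm_M_squared[OF M] pq
    by linarith
qed

text \<open>A \<open>0\<close>-cocoercive map has differences of dual norm \<open>0\<close>.\<close>

lemma cocoercive_zero_constant:
  fixes M :: "'h::{real_inner, complete_space} \<Rightarrow> 'h"
  assumes M: "M \<in> metric_ops" and C: "cocoercive_wrt M 0 C"
  shows "C y = C y'"
proof -
  obtain d where d: "C y - C y' = M d"
    using metric_ops_bij[OF M] by (metis bij_pointE)
  have "inner d (M d) \<le> 0"
    using C[unfolded cocoercive_wrt_def, rule_format, of y y']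
    unfolding d dual_norm_squared[OF M] by (simp add: inner_M_def)
  moreover obtain c where "c > 0" "c * (norm d)\<^sup>2 \<le> inner d (M d)"
    using M by (auto simp: metric_ops_def)
  ultimately have "d = 0"
    by (smt (verit) mult_le_0_iff norm_eq_zero power2_less_eq_zero_iff)
  moreover have "M 0 = 0"
    using M by (simp add: metric_ops_def linear_0 bounded_linear.linear)
  ultimately show ?thesis
    using d by simp
qed

lemma cocoercive_three_point_nonneg:
  fixes M :: "'h::{real_inner, complete_space} \<Rightarrow> 'h"
  assumes M: "M \<in> metric_ops" and C: "cocoercive_wrt M \<beta> C"
    and "0 \<le> \<beta>" "\<beta> \<le> bbar"
  shows "0 \<le> inner (C y - C y') (p - p') + bbar / 4 * (norm_M M ((p - y) - (p' - y')))\<^sup>2"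
proof (cases "\<beta> = 0")
  case True
  then have "C y = C y'"
    using cocoercive_zero_constant[OF M] C by blast
  then show ?thesis
    using assms by simp
next
  case False
  then have "0 \<le> bbar / 4 * (norm_M (inv M) ((2 / bbar) *\<^sub>R (C y - C y') + M ((p - y) - (p' - y'))))\<^sup>2
      + (bbar - \<beta>) / (bbar * \<beta>) * (norm_M (inv M) (C y - C y'))\<^sup>2"
    using assms by simp
  then show ?thesis
    using cocoercive_three_point[OF M C, of bbar y y' p p'] assms False by linarith
qed

lemma resolvent_graph_point:
  assumes "M \<in> metric_ops" "g > 0" "p \<in> resolvent M g A (M z - g *\<^sub>R c)"
  shows "M ((1 / g) *\<^sub>R (z - p)) - c \<in> A p"
proof -
  interpret bounded_linear M
    using assms by (simp add: metric_ops_def)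
  obtain a where a: "a \<in> A p" "M z - g *\<^sub>R c = M p + g *\<^sub>R a"
    using assms(3) by (auto simp: resolvent_def)
  have "M z - M p = g *\<^sub>R (a + c)"
    using a(2) by (simp add: algebra_simps)
  then have "M ((1 / g) *\<^sub>R (z - p)) - c = a"
    using assms(2) by (simp add: scaleR diff)
  then show ?thesis
    using a(1) by simp
qed

lemma monotone_inner_M:
  assumes "M \<in> metric_ops" "monotone_operator A" "M a - c \<in> A p" "M a' - c' \<in> A p'"
  shows "inner (c - c') (p - p') \<le> inner_M M (a - a') (p - p')"
proof -
  have "0 \<le> inner ((M a - c) - (M a' - c')) (p - p')"
    using assms by (auto simp: monotone_operator_def)
  moreover have "inner_M M (a - a') (p - p') = inner (M a - M a') (p - p')"
    using assms(1) by (simp add: inner_M_def metric_ops_def bounded_linear.linear linear_diff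
        inner_diff_left inner_diff_right)
  ultimately show ?thesis
    by (simp add: inner_diff_left)
qed

section \<open>Signs of the step parameters\<close>

text \<open>The choice of \<open>mu\<close> makes \<open>lam + mu = lam\<^sup>2 / lam 0\<close>. Both \<open>theta\<close> and \<open>theta_hat\<close> are this
  positive number times a factor in which only \<open>lam 0\<close> and \<open>gam * bbar\<close> occur, so growing
  relaxation parameters do not affect their signs.\<close>

lemma theta_pos:
  assumes "mu n = 1 / lam 0 * (lam n)\<^sup>2 - lam n" "lam 0 > 0" "lam n > 0"
    and "gam n * bbar < 4 - 2 * lam 0"
  shows "theta gam lam mu bbar n > 0"
proof -
  have "theta gam lam mu bbar n = (lam n)\<^sup>2 / lam 0 * (4 - 2 * lam 0 - gam n * bbar)"
    unfolding theta_def assms(1) using assms(2) by (simp add: field_simps)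
  then show ?thesis
    using assms by simp
qed

lemma theta_hat_pos:
  assumes "mu n = 1 / lam 0 * (lam n)\<^sup>2 - lam n" "lam 0 > 0" "lam n > 0"
    and "gam n * bbar < 4 - 2 * lam 0"
  shows "theta_hat gam lam mu bbar n > 0"
proof -
  have "gam n * bbar * lam 0 < (4 - 2 * lam 0) * lam 0"
    using assms by simp
  also have "\<dots> = 2 - 2 * (1 - lam 0)\<^sup>2"
    by (simp add: power2_eq_square algebra_simps)
  also have "\<dots> \<le> 2"
    by simp
  finally have "0 < 2 - gam n * bbar * lam 0"
    by simp
  moreover have "theta_hat gam lam mu bbar n = (lam n)\<^sup>2 / lam 0 * (2 - gam n * bbar * lam 0)"
    unfolding theta_hat_def assms(1) using assms(2) by (simp add: field_simps)
  ultimately show ?thesis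
    using assms by simp
qed

section \<open>The energy balance of one step\<close>

text \<open>Take \<open>xs\<close> as the origin. Since \<open>a = al a' + b\<close> and \<open>lam al = mu (1 - al)\<close>, the products with
  the old \<open>a'\<close> cancel. What is left is \<open>lam + mu\<close> times the product of \<open>b\<close> with
  \<open>p - al p' = e + (1 - al) x\<close>, and \<open>(lam + mu) (1 - al) = lam\<close>.\<close>

lemma inertial_product_balance:
  fixes lam mu :: real
  assumes M: "M \<in> metric_ops" and s: "lam + mu > 0" and al: "al = mu / (lam + mu)"
    and e: "e = p - x + al *\<^sub>R (x - p')" and a: "a = al *\<^sub>R a' + b"
  shows "lam * (inner_M M a (p - xs) - al * inner_M M a' (p' - xs)) + mu * inner_M M (a - a') (p - p')
    = (lam + mu) * inner_M M b e + lam * inner_M M b (x - xs)"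
proof -
  have mu: "mu = al * (lam + mu)"
    using s al by simp
  then have lam: "lam = (1 - al) * (lam + mu)"
    by (simp add: algebra_simps)
  define s where "s = lam + mu"
  have "(1 - al) * s * (inner_M M a (p - xs) - al * inner_M M a' (p' - xs))
      + al * s * inner_M M (a - a') (p - p')
    = s * inner_M M b e + (1 - al) * s * inner_M M b (x - xs)"
    unfolding a e by (simp add: inner_M_bilinear[OF M] algebra_simps)
  then show ?thesis
    unfolding s_def using lam mu by simp
qed

text \<open>By \<open>lam al = mu (1 - al)\<close> the coefficient of the squared \<open>q'\<close> is \<open>(lam + mu) al\<^sup>2\<close>, which is
  what completes the square of \<open>q - al q'\<close>.\<close>

lemma inertial_square_balance:
  fixes lam mu :: real
  assumes M: "M \<in> metric_ops" and s: "lam + mu > 0" and al: "al = mu / (lam + mu)"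
    and q: "q = al *\<^sub>R q' + r"
  shows "lam * (inner_M M q q - al * inner_M M q' q') + mu * inner_M M (q - q') (q - q')
    = (lam + mu) * inner_M M r r"
proof -
  have mu: "mu = al * (lam + mu)"
    using s al by simp
  then have lam: "lam = (1 - al) * (lam + mu)"
    by (simp add: algebra_simps)
  define s where "s = lam + mu"
  have "(1 - al) * s * (inner_M M q q - al * inner_M M q' q') + al * s * inner_M M (q - q') (q - q')
    = s * inner_M M r r"
    unfolding q using inner_M_commute[OF M, of r q']
    by (simp add: inner_M_bilinear[OF M] algebra_simps)
  then show ?thesis
    unfolding s_def using lam mu by simp
qed

text \<open>After the cancellations a quadratic form in \<open>e, u, v\<close> remains. The parameters
  \<open>theta\<close>, \<open>theta_hat\<close> and \<open>theta_bar\<close> (here \<open>th\<close>, \<open>hat\<close> and \<open>br\<close>) are the numbers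
  that make the square of weight \<open>th / 2\<close> absorb every term containing \<open>e\<close> and the mixed term in \<open>u\<close> and \<open>v\<close>. Further, \<open>s\<close> stands for \<open>lam + mu\<close> and \<open>k\<close> for \<open>gam * bbar\<close>.\<close>

lemma deviation_balance:
  fixes lam s k :: real
  assumes M: "M \<in> metric_ops" and th: "th = (4 - k) * s - 2 * lam\<^sup>2" "th > 0"
    and hat: "hat = 2 * s - k * lam\<^sup>2" "hat > 0" and br: "br = s - lam\<^sup>2"
    and g: "g = (br * k / hat) *\<^sub>R u + v - e"
    and w: "w = e + (k * lam\<^sup>2 / hat) *\<^sub>R u - (2 * br / th) *\<^sub>R v"
  shows "2 * s * inner_M M g e + lam\<^sup>2 * inner_M M g g + k * s / 2 * inner_M M (e - u) (e - u)
      + th / 2 * inner_M M w w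
    = s * (s * k / hat * inner_M M u u + hat / th * inner_M M v v)"
proof -
  let ?I = "inner_M M"
  define c where "c = br * k / hat"
  define h where "h = k * lam\<^sup>2 / hat"
  define m where "m = 2 * br / th"
  have key: "2 * br\<^sup>2 + th * lam\<^sup>2 = s * hat"
    unfolding th(1) hat(1) br by (simp add: power2_eq_square algebra_simps)
  have ee: "- 2 * s + lam\<^sup>2 + k * s / 2 + th / 2 = 0"
    unfolding th(1) by (simp add: field_simps)
  have ev: "2 * s - 2 * lam\<^sup>2 - th * m = 0"
    using th(2) by (simp add: m_def br)
  have eu: "2 * s * c - 2 * lam\<^sup>2 * c - k * s + th * h = 0"
  proof -
    have "2 * s * c - 2 * lam\<^sup>2 * c - k * s + th * h = k * (2 * br\<^sup>2 + th * lam\<^sup>2 - s * hat) / hat"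
      using hat(2) by (simp add: c_def h_def br field_simps power2_eq_square)
    then show ?thesis
      using key by simp
  qed
  have uv: "2 * lam\<^sup>2 * c - th * h * m = 0"
    using th(2) hat(2) by (simp add: c_def h_def m_def)
  have vv: "lam\<^sup>2 + th * m\<^sup>2 / 2 = s * (hat / th)"
  proof -
    have "lam\<^sup>2 + th * m\<^sup>2 / 2 = (2 * br\<^sup>2 + th * lam\<^sup>2) / th"
      using th(2) by (simp add: m_def field_simps power2_eq_square)
    then show ?thesis
      using key by simp
  qed
  have uu: "lam\<^sup>2 * c\<^sup>2 + k * s / 2 + th * h\<^sup>2 / 2 = s * (s * k / hat)"
  proof -
    have "lam\<^sup>2 * c\<^sup>2 + th * h\<^sup>2 / 2 = lam\<^sup>2 * k\<^sup>2 * (2 * br\<^sup>2 + th * lam\<^sup>2) / (2 * hat\<^sup>2)"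
      using hat(2) by (simp add: c_def h_def field_simps power2_eq_square)
    also have "\<dots> = lam\<^sup>2 * k\<^sup>2 * s / (2 * hat)"
      using hat(2) unfolding key by (simp add: power2_eq_square)
    also have "\<dots> + k * s / 2 = k * s * (lam\<^sup>2 * k + hat) / (2 * hat)"
      using hat(2) by (simp add: field_simps power2_eq_square)
    also have "lam\<^sup>2 * k + hat = 2 * s"
      by (simp add: hat(1))
    finally show ?thesis
      by (simp add: algebra_simps)
  qed
  have sym: "?I u e = ?I e u" "?I v e = ?I e v" "?I v u = ?I u v"
    using inner_M_commute[OF M] by auto
  have "2 * s * ?I g e + lam\<^sup>2 * ?I g g + k * s / 2 * ?I (e - u) (e - u) + th / 2 * ?I w w
     = (- 2 * s + lam\<^sup>2 + k * s / 2 + th / 2) * ?I e e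
       + (2 * s - 2 * lam\<^sup>2 - th * m) * ?I e v
       + (2 * s * c - 2 * lam\<^sup>2 * c - k * s + th * h) * ?I e u
       + (2 * lam\<^sup>2 * c - th * h * m) * ?I u v
       + (lam\<^sup>2 + th * m\<^sup>2 / 2) * ?I v v
       + (lam\<^sup>2 * c\<^sup>2 + k * s / 2 + th * h\<^sup>2 / 2) * ?I u u"
    unfolding g w c_def[symmetric] h_def[symmetric] m_def[symmetric]
    by (simp add: inner_M_bilinear[OF M] sym power2_eq_square field_simps)
  then show ?thesis
    unfolding ee ev eu uv vv uu by (simp add: distrib_left)
qed

text \<open>The vector \<open>e = p - x + al (x - p')\<close> controls a whole step: \<open>gam (a - al a')\<close> and
  \<open>q - al q'\<close>, where \<open>q = p - y\<close>, are \<open>- e\<close> and \<open>e\<close> up to the deviations, and the new \<open>x\<close> is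
  \<open>x - lam gam (a - al a')\<close>. The products with \<open>x - xs\<close> from the squared distance and from the
  balance of products cancel, which leaves the form in \<open>e, u, v\<close>.\<close>

lemma energy_balance:
  fixes lam mu gam bbar :: real
  assumes M: "M \<in> metric_ops" and gam: "gam > 0" and s: "lam + mu > 0"
    and al: "al = mu / (lam + mu)"
    and th: "th = (4 - gam * bbar) * (lam + mu) - 2 * lam\<^sup>2" "th > 0"
    and hat: "hat = 2 * (lam + mu) - gam * bbar * lam\<^sup>2" "hat > 0"
    and br: "br = lam + mu - lam\<^sup>2"
    and y: "y = x + al *\<^sub>R (y' - x) + u"
    and z: "z = x + al *\<^sub>R (p' - x) + (gam * al) *\<^sub>R a' + (br * gam * bbar / hat) *\<^sub>R u + v"
    and x_new: "x_new = x + lam *\<^sub>R (p - z) + (gam * al * lam) *\<^sub>R a'"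
    and a: "a = (1 / gam) *\<^sub>R (z - p)"
    and w: "w = p - x + al *\<^sub>R (x - p') + (gam * bbar * lam\<^sup>2 / hat) *\<^sub>R u - (2 * br / th) *\<^sub>R v"
  shows "inner_M M (x_new - xs) (x_new - xs)
      + 2 * gam * lam * (inner_M M a (p - xs) + bbar / 4 * inner_M M (p - y) (p - y))
      + (th / 2 * inner_M M w w + 2 * mu * gam * inner_M M (a - a') (p - p')
         + mu * gam * bbar / 2 * inner_M M (p - y - (p' - y')) (p - y - (p' - y')))
    = inner_M M (x - xs) (x - xs)
      + 2 * lam * gam * al * (inner_M M a' (p' - xs) + bbar / 4 * inner_M M (p' - y') (p' - y'))
      + (lam + mu) * ((lam + mu) * gam * bbar / hat * inner_M M u u + hat / th * inner_M M v v)"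
proof -
  let ?I = "inner_M M"
  define e where "e = p - x + al *\<^sub>R (x - p')"
  define g where "g = (br * (gam * bbar) / hat) *\<^sub>R u + v - e"
  define b where "b = (1 / gam) *\<^sub>R g"
  have zp: "z - p = (gam * al) *\<^sub>R a' + g"
    unfolding z g_def e_def by (simp add: algebra_simps)
  have ab: "a = al *\<^sub>R a' + b"
    unfolding a zp b_def using gam by (simp add: scaleR_add_right)
  have q: "p - y = al *\<^sub>R (p' - y') + (e - u)"
    unfolding y e_def by (simp add: algebra_simps)
  have we: "w = e + (gam * bbar * lam\<^sup>2 / hat) *\<^sub>R u - (2 * br / th) *\<^sub>R v"
    unfolding w e_def ..
  have "x_new = x - lam *\<^sub>R ((z - p) - (gam * al) *\<^sub>R a')"
    unfolding x_new by (simp add: algebra_simps)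
  then have "x_new - xs = (x - xs) - lam *\<^sub>R g"
    by (simp add: zp algebra_simps)
  moreover have "?I (d - lam *\<^sub>R g) (d - lam *\<^sub>R g) = ?I d d - 2 * lam * ?I g d + lam\<^sup>2 * ?I g g" for d
    using inner_M_commute[OF M, of d g]
    by (simp add: inner_M_bilinear[OF M] power2_eq_square algebra_simps)
  ultimately have dist: "?I (x_new - xs) (x_new - xs)
      = ?I (x - xs) (x - xs) - 2 * lam * ?I g (x - xs) + lam\<^sup>2 * ?I g g"
    by (simp only:)
  have gb: "gam * ?I b t = ?I g t" for t
    using gam by (simp add: b_def inner_M_bilinear[OF M])
  have "gam * (lam * (?I a (p - xs) - al * ?I a' (p' - xs)) + mu * ?I (a - a') (p - p'))
     = (lam + mu) * (gam * ?I b e) + lam * (gam * ?I b (x - xs))"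
    using inertial_product_balance[OF M s al e_def ab, of xs] by (simp add: algebra_simps)
  then have prods: "gam * (lam * (?I a (p - xs) - al * ?I a' (p' - xs)) + mu * ?I (a - a') (p - p'))
     = (lam + mu) * ?I g e + lam * ?I g (x - xs)"
    unfolding gb .
  define Q where "Q = ?I (p - y) (p - y)"
  define Q' where "Q' = ?I (p' - y') (p' - y')"
  define D where "D = ?I (p - y - (p' - y')) (p - y - (p' - y'))"
  have squares: "gam * bbar * (lam * (Q - al * Q') + mu * D)
     = gam * bbar * ((lam + mu) * ?I (e - u) (e - u))"
    using inertial_square_balance[OF M s al q] unfolding Q_def Q'_def D_def by simp
  have "2 * gam * lam * (?I a (p - xs) + bbar / 4 * Q)
      + (th / 2 * ?I w w + 2 * mu * gam * ?I (a - a') (p - p') + mu * gam * bbar / 2 * D)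
      - 2 * lam * gam * al * (?I a' (p' - xs) + bbar / 4 * Q')
    = 2 * (gam * (lam * (?I a (p - xs) - al * ?I a' (p' - xs)) + mu * ?I (a - a') (p - p')))
      + gam * bbar * (lam * (Q - al * Q') + mu * D) / 2 + th / 2 * ?I w w"
    by (simp add: field_simps)
  also have "\<dots> = 2 * ((lam + mu) * ?I g e + lam * ?I g (x - xs))
      + gam * bbar * ((lam + mu) * ?I (e - u) (e - u)) / 2 + th / 2 * ?I w w"
    unfolding prods squares ..
  also have "\<dots> = 2 * lam * ?I g (x - xs) - lam\<^sup>2 * ?I g g
      + (2 * (lam + mu) * ?I g e + lam\<^sup>2 * ?I g g
        + gam * bbar * (lam + mu) / 2 * ?I (e - u) (e - u) + th / 2 * ?I w w)"
    by (simp add: field_simps)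
  also have "\<dots> = 2 * lam * ?I g (x - xs) - lam\<^sup>2 * ?I g g
      + (lam + mu) * ((lam + mu) * gam * bbar / hat * ?I u u + hat / th * ?I v v)"
    using deviation_balance[OF M th hat br g_def we] by (simp add: mult.assoc)
  finally show ?thesis
    using dist unfolding Q_def[symmetric] Q'_def[symmetric] D_def[symmetric]
    by linarith
qed

section \<open>The Lyapunov inequality\<close>

theorem theorem2:
  fixes M C :: "'h::{real_inner, complete_space} \<Rightarrow> 'h"
    and A :: "'h \<Rightarrow> 'h set"
    and \<beta> bbar eps eps0 eps1 :: real
    and gam lam zeta mu :: "nat \<Rightarrow> real"
    and x y z p u v :: "nat \<Rightarrow> 'h"
    and xs :: 'h
  assumes "M \<in> metric_ops"
    and "\<beta> \<ge> 0"
    and "maximally_monotone A"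
    and "cocoercive_wrt M \<beta> C"
    and "zer_sum A C \<noteq> {}"
    and "\<And>n. gam n > 0"
    and "\<And>n. lam n > 0"
    and "\<And>n. zeta n \<ge> 0"
    and "\<And>n. mu n \<ge> 0"
    and "bbar \<ge> \<beta>"
    and "eps > 0"
    and "eps0 \<ge> 0"
    and "eps1 \<ge> 0"
    and "\<And>n. mu n = 1 / lam 0 * (lam n)\<^sup>2 - lam n"
    and "\<And>n. zeta n \<le> 1 - eps0"
    and "\<And>n. eps \<le> gam n * bbar"
    and "\<And>n. gam n * bbar \<le> 4 - 2 * lam 0 - eps"
    and "\<And>n. lam (Suc n) \<ge> lam n"
    and "\<And>n. gam (Suc n) * lam (Suc n) - gam n * lam n \<le> gam (Suc n) * lam 0 - eps1"
    and "generated_by_algorithm M A C gam lam zeta mu bbar x y z p u v"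
    and "xs \<in> zer_sum A C"
  shows "\<forall>n.
    \<comment> \<open>(i)\<close>
    (zeta (Suc n) * ell M gam lam mu bbar x y z p u v n
       \<ge> zeta (Suc n) * theta gam lam mu bbar n / 2
           * (norm_M M (ell_vec gam lam mu bbar x p u v n))\<^sup>2 \<and>
     zeta (Suc n) * theta gam lam mu bbar n / 2
           * (norm_M M (ell_vec gam lam mu bbar x p u v n))\<^sup>2 \<ge> 0) \<and>
    \<comment> \<open>(ii)\<close>
    safeguard_lhs M gam lam mu bbar u v (Suc n) \<ge> 0 \<and>
    \<comment> \<open>(iii)\<close>
    (phi M gam bbar y z p xs n \<ge> 0 \<and>
     (\<beta> > 0 \<longrightarrow>
        phi M gam bbar y z p xs n
          \<ge> bbar / 4 * (norm_M (inv M) ((2 / bbar) *\<^sub>R (C (y n) - C xs) + M (p n - y n)))\<^sup>2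
             + (bbar - \<beta>) / (bbar * \<beta>) * (norm_M (inv M) (C (y n) - C xs))\<^sup>2 \<and>
        bbar / 4 * (norm_M (inv M) ((2 / bbar) *\<^sub>R (C (y n) - C xs) + M (p n - y n)))\<^sup>2
             + (bbar - \<beta>) / (bbar * \<beta>) * (norm_M (inv M) (C (y n) - C xs))\<^sup>2 \<ge> 0) \<and>
     (\<beta> = 0 \<longrightarrow>
        phi M gam bbar y z p xs n \<ge> bbar / 4 * (norm_M M (p n - y n))\<^sup>2 \<and>
        bbar / 4 * (norm_M M (p n - y n))\<^sup>2 \<ge> 0)) \<and>
    \<comment> \<open>(iv)\<close>
    V M gam lam mu bbar x y z p u v xs n \<ge> 0 \<and>
    \<comment> \<open>(v)\<close>
    V M gam lam mu bbar x y z p u v xs (Suc n)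
      + 2 * gam n * (lam n - alpha_bar gam lam mu (Suc n) * lam (Suc n)) * phi M gam bbar y z p xs n
      + (1 - zeta n) * prev 0 (ell M gam lam mu bbar x y z p u v) n
      \<le> V M gam lam mu bbar x y z p u v xs n"
proof -
  note M = assms(1) and gam = assms(6) and lam = assms(7) and zeta = assms(8) and mu = assms(9)
  have bbar: "bbar > 0"
    using assms(11) assms(16)[of 0] gam[of 0] by (smt (verit) mult_nonneg_nonpos)
  have bound: "gam n * bbar < 4 - 2 * lam 0" for n
    using assms(17)[of n] assms(11) by simp
  have th: "theta gam lam mu bbar n > 0" for n
    by (rule theta_pos) (use assms(14) lam bound in auto)
  have hat: "theta_hat gam lam mu bbar n > 0" for n
    by (rule theta_hat_pos) (use assms(14) lam bound in auto)
  have s: "lam n + mu n > 0" for n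
    using lam[of n] mu[of n] by simp
  have mu0: "mu 0 = 0"
    using assms(14)[of 0] lam[of 0] by (simp add: power2_eq_square)
  have mono: "monotone_operator A"
    using assms(3) by (simp add: maximally_monotone_def)
  note gen = assms(20)[unfolded generated_by_algorithm_def]
  define a where "a n = (1 / gam n) *\<^sub>R (z n - p n)" for n
  define a' where "a' n = (1 / prev (gam 0) gam n) *\<^sub>R (prev (x 0) z n - prev (x 0) p n)" for n
  have graph: "M (a n) - C (y n) \<in> A (p n)" for n
    unfolding a_def using gen gam by (intro resolvent_graph_point[OF M]) auto
  have M0: "M 0 = 0"
    using M by (simp add: metric_ops_def linear_0 bounded_linear.linear)
  have graph_xs: "M 0 - C xs \<in> A xs"
  proof -
    obtain c where "c \<in> A xs" "0 = c + C xs"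
      using assms(21) by (auto simp: zer_sum_def)
    then have "c = - C xs"
      by (simp add: eq_neg_iff_add_eq_0)
    then show ?thesis
      using \<open>c \<in> A xs\<close> by (simp add: M0)
  qed

  have norm_diff_commute: "(norm_M M (r - t))\<^sup>2 = (norm_M M (t - r))\<^sup>2" for r t
    by (simp add: norm_M_squared[OF M] inner_M_bilinear[OF M])
  have phi_lower: "inner (C (y n) - C xs) (p n - xs)
      + bbar / 4 * (norm_M M ((p n - y n) - (xs - xs)))\<^sup>2 \<le> phi M gam bbar y z p xs n" for n
    using monotone_inner_M[OF M mono graph graph_xs, of n]
    by (simp add: phi_def a_def norm_diff_commute[of "y n" "p n"])
  have phi_nonneg: "0 \<le> phi M gam bbar y z p xs n" for n
    using cocoercive_three_point_nonneg[OF M assms(4,2,10), of "y n" xs "p n" xs] phi_lower[of n]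
    by linarith

  have ell_lower: "theta gam lam mu bbar n / 2 * (norm_M M (ell_vec gam lam mu bbar x p u v n))\<^sup>2
      \<le> ell M gam lam mu bbar x y z p u v n" for n
  proof (cases n)
    \<comment> \<open>The starting values at index \<open>-1\<close> need not satisfy an inclusion, so monotonicity says nothing for
      \<open>n = 0\<close>; there \<open>mu 0 = 0\<close> removes both terms.\<close>
    case 0
    then show ?thesis
      by (simp add: ell_def mu0)
  next
    case (Suc k)
    have "0 \<le> inner_M M (a n - a k) (p n - p k)
        + bbar / 4 * (norm_M M (p n - y n - (p k - y k)))\<^sup>2"
      using cocoercive_three_point_nonneg[OF M assms(4,2,10), of "y n" "y k" "p n" "p k"]
        monotone_inner_M[OF M mono graph graph, of n k]
      by linarith
    then have "0 \<le> 2 * mu n * gam n * (inner_M M (a n - a k) (p n - p k)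
        + bbar / 4 * (norm_M M (p n - y n - (p k - y k)))\<^sup>2)"
      using mu[of n] gam[of n] by simp
    then show ?thesis
      by (simp add: ell_def Suc prev_def a_def algebra_simps)
  qed
  have ell_nonneg: "0 \<le> ell M gam lam mu bbar x y z p u v n" for n
    using ell_lower[of n] th[of n]
    by (smt (verit) divide_nonneg_nonneg mult_nonneg_nonneg zero_le_power2)

  have i: "zeta (Suc n) * ell M gam lam mu bbar x y z p u v n
       \<ge> zeta (Suc n) * theta gam lam mu bbar n / 2
           * (norm_M M (ell_vec gam lam mu bbar x p u v n))\<^sup>2 \<and>
     zeta (Suc n) * theta gam lam mu bbar n / 2
           * (norm_M M (ell_vec gam lam mu bbar x p u v n))\<^sup>2 \<ge> 0" for n
    using mult_left_mono[OF ell_lower[of n] zeta[of "Suc n"]] th[of n] zeta[of "Suc n"]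
    by (simp add: mult.assoc)

  have ii: "safeguard_lhs M gam lam mu bbar u v n \<ge> 0" for n
    using s[of n] th[of n] hat[of n] gam[of n] bbar
    by (simp add: safeguard_lhs_def theta_tilde_def)

  have iii: "phi M gam bbar y z p xs n \<ge> 0 \<and>
     (\<beta> > 0 \<longrightarrow>
        phi M gam bbar y z p xs n
          \<ge> bbar / 4 * (norm_M (inv M) ((2 / bbar) *\<^sub>R (C (y n) - C xs) + M (p n - y n)))\<^sup>2
             + (bbar - \<beta>) / (bbar * \<beta>) * (norm_M (inv M) (C (y n) - C xs))\<^sup>2 \<and>
        bbar / 4 * (norm_M (inv M) ((2 / bbar) *\<^sub>R (C (y n) - C xs) + M (p n - y n)))\<^sup>2
             + (bbar - \<beta>) / (bbar * \<beta>) * (norm_M (inv M) (C (y n) - C xs))\<^sup>2 \<ge> 0) \<and>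
     (\<beta> = 0 \<longrightarrow>
        phi M gam bbar y z p xs n \<ge> bbar / 4 * (norm_M M (p n - y n))\<^sup>2 \<and>
        bbar / 4 * (norm_M M (p n - y n))\<^sup>2 \<ge> 0)" (is "_ \<and> ?pos \<and> ?zero") for n
  proof (intro conjI phi_nonneg)
    show ?pos
      using cocoercive_three_point[OF M assms(4) _ assms(10), of "y n" xs "p n" xs] phi_lower[of n]
        assms(10) bbar by auto
    show ?zero
      using cocoercive_zero_constant[OF M, of C "y n" xs] assms(4) phi_lower[of n] bbar by auto
  qed

  \<comment> \<open>The two cases of \<open>V\<close> in one formula, in which \<open>phi\<close> and \<open>ell\<close> have the value \<open>0\<close> at \<open>-1\<close>.\<close>
  have V_eq: "V M gam lam mu bbar x y z p u v xs n = (norm_M M (x n - xs))\<^sup>2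
      + 2 * lam n * gam n * alpha lam mu n * prev 0 (phi M gam bbar y z p xs) n
      + prev 0 (ell M gam lam mu bbar x y z p u v) n" for n
    by (cases n) (simp_all add: V_def prev_def)
  have alpha_nonneg: "0 \<le> alpha lam mu n" for n
    using s[of n] mu[of n] by (simp add: alpha_def)
  have iv: "V M gam lam mu bbar x y z p u v xs n \<ge> 0" for n
    using alpha_nonneg lam gam phi_nonneg ell_nonneg
    by (cases n) (simp_all add: V_eq prev_def less_imp_le)

  have alpha_bar: "alpha_bar gam lam mu n = gam n * alpha lam mu n / prev (gam 0) gam n" for n
    by (simp add: alpha_bar_def alpha_def)
  have prev_gam: "prev (gam 0) gam n > 0" for n
    using gam by (cases n) (simp_all add: prev_def)
  have inertia: "alpha_bar gam lam mu n *\<^sub>R (prev (x 0) z n - prev (x 0) p n)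
      = (gam n * alpha lam mu n) *\<^sub>R a' n" for n
    by (simp add: a'_def alpha_bar)
  \<comment> \<open>The inequality in (v) before any estimate: the safeguarded quantity is the exact defect.\<close>
  have balance: "(norm_M M (x (Suc n) - xs))\<^sup>2 + 2 * gam n * lam n * phi M gam bbar y z p xs n
      + ell M gam lam mu bbar x y z p u v n
    = (norm_M M (x n - xs))\<^sup>2
      + 2 * lam n * gam n * alpha lam mu n * prev 0 (phi M gam bbar y z p xs) n
      + safeguard_lhs M gam lam mu bbar u v n" for n
  proof -
    have y: "y n = x n + alpha lam mu n *\<^sub>R (prev (x 0) y n - x n) + u n"
      using gen by blast
    have z: "z n = x n + alpha lam mu n *\<^sub>R (prev (x 0) p n - x n)
        + (gam n * alpha lam mu n) *\<^sub>R a' n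
        + (theta_bar lam mu n * gam n * bbar / theta_hat gam lam mu bbar n) *\<^sub>R u n + v n"
      using gen unfolding inertia by blast
    have "x (Suc n) = x n + lam n *\<^sub>R (p n - z n)
        + lam n *\<^sub>R (alpha_bar gam lam mu n *\<^sub>R (prev (x 0) z n - prev (x 0) p n))"
      using gen by (simp add: mult.commute)
    then have x_new: "x (Suc n) = x n + lam n *\<^sub>R (p n - z n)
        + (gam n * alpha lam mu n * lam n) *\<^sub>R a' n"
      unfolding inertia by (simp add: mult.commute mult.left_commute)
    have hat_eq: "theta_hat gam lam mu bbar n = 2 * (lam n + mu n) - gam n * bbar * (lam n)\<^sup>2"
      by (simp add: theta_hat_def)
    \<comment> \<open>At \<open>n = 0\<close> both sides vanish, because \<open>mu 0 = 0\<close>.\<close>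
    have phi_prev: "alpha lam mu n * prev 0 (phi M gam bbar y z p xs) n
        = alpha lam mu n * (inner_M M (a' n) (prev (x 0) p n - xs)
          + bbar / 4 * (norm_M M (prev (x 0) p n - prev (x 0) y n))\<^sup>2)"
      by (cases n) (simp_all add: alpha_def mu0 phi_def prev_def a'_def
          norm_diff_commute[of "y _" "p _"])
    have phi_eq: "phi M gam bbar y z p xs n
        = inner_M M (a n) (p n - xs) + bbar / 4 * (norm_M M (p n - y n))\<^sup>2"
      by (simp add: phi_def a_def norm_diff_commute[of "y n" "p n"])
    note step = energy_balance[OF M gam[of n] s[of n] alpha_def[of lam mu n]
        theta_def[of gam lam mu bbar n] th[of n] hat_eq hat[of n] theta_bar_def[of lam mu n]
        y z x_new a_def[of n] ell_vec_def[of gam lam mu bbar x p u v n], of xs]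
    show ?thesis
      using step phi_prev
      unfolding phi_eq ell_def safeguard_lhs_def theta_tilde_def a_def[symmetric] a'_def[symmetric]
        norm_M_squared[OF M, symmetric]
      by (auto simp: mult.assoc)
  qed
  have safe: "safeguard_lhs M gam lam mu bbar u v n
      \<le> zeta n * prev 0 (ell M gam lam mu bbar x y z p u v) n" for n
    using gen M0 by (cases n) (simp_all add: prev_def safeguard_lhs_def norm_M_def)
  have v: "V M gam lam mu bbar x y z p u v xs (Suc n)
      + 2 * gam n * (lam n - alpha_bar gam lam mu (Suc n) * lam (Suc n)) * phi M gam bbar y z p xs n
      + (1 - zeta n) * prev 0 (ell M gam lam mu bbar x y z p u v) n
      \<le> V M gam lam mu bbar x y z p u v xs n" for n
  proof -
    \<comment> \<open>By this equation the term with \<open>phi\<close> inside the new \<open>V\<close> cancels against the part with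
      \<open>alpha_bar\<close> of the separate term.\<close>
    have "gam n * alpha_bar gam lam mu (Suc n) = gam (Suc n) * alpha lam mu (Suc n)"
      using gam[of n] by (simp add: alpha_bar prev_def)
    then have "gam n * (lam n - alpha_bar gam lam mu (Suc n) * lam (Suc n))
        = gam n * lam n - lam (Suc n) * gam (Suc n) * alpha lam mu (Suc n)"
      by (simp add: right_diff_distrib mult.commute mult.left_commute)
    then have "V M gam lam mu bbar x y z p u v xs (Suc n)
      + 2 * gam n * (lam n - alpha_bar gam lam mu (Suc n) * lam (Suc n)) * phi M gam bbar y z p xs n
      = (norm_M M (x (Suc n) - xs))\<^sup>2 + 2 * gam n * lam n * phi M gam bbar y z p xs n
        + ell M gam lam mu bbar x y z p u v n"
      by (simp add: V_def mult.assoc left_diff_distrib)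
    then show ?thesis
      using balance[of n] safe[of n] unfolding V_eq[of n] by (simp add: left_diff_distrib)
  qed
  show ?thesis
    using i ii iii iv v by blast
qed

end
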